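(* Let $\alpha\in(0,\pi)$ and let $n\geq 1$ be an integer. The system $T_{2n}^{\alpha}$ of constrained trivariate functions forms a basis of the vector space $\mathcal{V}_{n}^{\alpha}$, i.e., $$\mathcal{T}_{2n}^{\alpha}=\operatorname{span} T_{2n}^{\alpha}=\operatorname{span} V_{n}^{\alpha}=\mathcal{V}_{n}^{\alpha}.$$
   Context: For $\alpha\in(0,\pi)$ let $\Omega^{\alpha}=\{(u,v,w)\in[0,\alpha]^3: u+v+w=\alpha\}$. All functions below are real-valued functions of $(u,v,w)\in\Omega^{\alpha}$, and spans are over $\mathbb{R}$. For an integer $n\ge 1$, $0\le j\le n$ and $j\le i\le 2n-j$, define $$R_{2n,2n-i,j}^{\alpha}(u,v,w)=\begin{cases}\sin^{2n-i}\frac{u}{2}\,\sin^{i}\frac{w}{2}\,\cos^{i-j}\frac{v}{2}\,\sin^{j}\frac{v}{2}, & j\le i\le n,\\[4pt] \sin^{2n-i}\frac{u}{2}\,\sin^{i}\frac{w}{2}\,\cos^{2n-i-j}\frac{v}{2}\,\sin^{j}\frac{v}{2}, & n+1\le i\le 2n-j,\end{cases}$$ and, by cyclic permutation of the variables, $$G_{2n,2n-i,j}^{\alpha}(u,v,w)=R_{2n,2n-i,j}^{\alpha}(w,u,v),\qquad B_{2n,2n-i,j}^{\alpha}(u,v,w)=R_{2n,2n-i,j}^{\alpha}(v,w,u).$$ Note that $R_{2n,n,n}^{\alpha}=G_{2n,n,n}^{\alpha}=B_{2n,n,n}^{\alpha}=\sin^n\frac{u}{2}\sin^n\frac{v}{2}\sin^n\frac{w}{2}$.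 The joint function system of order $n$ is $$T_{2n}^{\alpha}=\left\{R_{2n,2n-i,j}^{\alpha},\ G_{2n,2n-i,j}^{\alpha},\ B_{2n,2n-i,j}^{\alpha}\ :\ 0\le j\le n-1,\ j\le i\le 2n-1-j\right\}\cup\left\{R_{2n,n,n}^{\alpha}\right\},$$ regarded as a family indexed by the letter ($R$, $G$ or $B$) and the pair $(i,j)$, together with the single function $R_{2n,n,n}^{\alpha}$. $V_n^{\alpha}$ denotes a largest linearly independent subset of the function system $$\left\{\cos(ru+gv+bw),\ \sin(ru+gv+bw)\ :\ r,g,b\in\{0,1,\ldots,n\}\right\}$$ on $\Omega^{\alpha}$, and $\mathcal{V}_n^{\alpha}=\operatorname{span}V_n^{\alpha}$ (so $\mathcal{V}_n^{\alpha}$ is the span of that whole function system). *)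

theory Defs
  imports "HOL-Analysis.Analysis" "HOL-Library.Function_Algebras"
begin

instantiation "fun" :: (type, real_vector) real_vector
begin

definition scaleR_fun :: "real \<Rightarrow> ('a \<Rightarrow> 'b) \<Rightarrow> 'a \<Rightarrow> 'b" where
  "scaleR_fun c f = (\<lambda>x. c *\<^sub>R f x)"

instance
  by standard (auto simp: scaleR_fun_def plus_fun_def fun_eq_iff algebra_simps)

end

definition Omega :: "real \<Rightarrow> (real \<times> real \<times> real) set" where
  "Omega \<alpha> = {(u, v, w). u \<in> {0..\<alpha>} \<and> v \<in> {0..\<alpha>} \<and> w \<in> {0..\<alpha>} \<and> u + v + w = \<alpha>}"

text \<open>
  A real-valued function on \<open>Omega \<alpha>\<close> is represented by its extension by zero. Functions vanishing
  off \<open>Omega \<alpha>\<close> form a linear subspace isomorphic to the space of functions on \<open>Omega \<alpha>\<close>,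
  so equality, \<^const>\<open>span\<close> and \<^const>\<open>independent\<close> mean what they mean on \<open>Omega \<alpha>\<close>.
\<close>

type_synonym trifun = "real \<times> real \<times> real \<Rightarrow> real"

definition on_Omega :: "real \<Rightarrow> trifun \<Rightarrow> trifun" where
  "on_Omega \<alpha> f = (\<lambda>p. if p \<in> Omega \<alpha> then f p else 0)"

text \<open>
  \<open>Rfun n i j\<close> is the formula for \<open>R\<^sub>2\<^sub>n\<^sub>,\<^sub>2\<^sub>n\<^sub>-\<^sub>i\<^sub>,\<^sub>j\<close>: the argument \<open>i\<close> is the exponent
  of \<open>sin (w / 2)\<close>, not the printed subscript \<open>2n - i\<close>. It is meant for \<open>j \<le> n\<close> and
  \<open>j \<le> i \<le> 2n - j\<close>, where none of the subtractions in the exponents truncates.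
\<close>

definition Rfun :: "nat \<Rightarrow> nat \<Rightarrow> nat \<Rightarrow> trifun" where
  "Rfun n i j = (\<lambda>(u, v, w).
     if i \<le> n
     then sin (u / 2) ^ (2 * n - i) * sin (w / 2) ^ i * cos (v / 2) ^ (i - j) * sin (v / 2) ^ j
     else sin (u / 2) ^ (2 * n - i) * sin (w / 2) ^ i * cos (v / 2) ^ (2 * n - i - j) * sin (v / 2) ^ j)"

definition Gfun :: "nat \<Rightarrow> nat \<Rightarrow> nat \<Rightarrow> trifun" where
  "Gfun n i j = (\<lambda>(u, v, w). Rfun n i j (w, u, v))"

definition Bfun :: "nat \<Rightarrow> nat \<Rightarrow> nat \<Rightarrow> trifun" where
  "Bfun n i j = (\<lambda>(u, v, w). Rfun n i j (v, w, u))"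

datatype letter = Red | Green | Blue

fun T_fun :: "real \<Rightarrow> nat \<Rightarrow> letter \<times> nat \<times> nat \<Rightarrow> trifun" where
  "T_fun \<alpha> n (Red, i, j) = on_Omega \<alpha> (Rfun n i j)"
| "T_fun \<alpha> n (Green, i, j) = on_Omega \<alpha> (Gfun n i j)"
| "T_fun \<alpha> n (Blue, i, j) = on_Omega \<alpha> (Bfun n i j)"

definition T_index :: "nat \<Rightarrow> (letter \<times> nat \<times> nat) set" where
  "T_index n = {(c, i, j). j \<le> n - 1 \<and> j \<le> i \<and> i \<le> 2 * n - 1 - j} \<union> {(Red, n, n)}"

definition T_system :: "real \<Rightarrow> nat \<Rightarrow> trifun set" where
  "T_system \<alpha> n = T_fun \<alpha> n ` T_index n"

definition trig_system :: "real \<Rightarrow> nat \<Rightarrow> trifun set" where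
  "trig_system \<alpha> n =
     (\<Union>r\<in>{0..n}. \<Union>g\<in>{0..n}. \<Union>b\<in>{0..n}.
        {on_Omega \<alpha> (\<lambda>(u, v, w). cos (real r * u + real g * v + real b * w)),
         on_Omega \<alpha> (\<lambda>(u, v, w). sin (real r * u + real g * v + real b * w))})"

text \<open>Comparing cardinalities is only meaningful for finite \<open>S\<close>, such as \<open>trig_system \<alpha> n\<close>.\<close>

definition largest_independent_subset :: "'a::real_vector set \<Rightarrow> 'a set \<Rightarrow> bool" where
  "largest_independent_subset V S \<longleftrightarrow>
     V \<subseteq> S \<and> independent V \<and> (\<forall>W. W \<subseteq> S \<and> independent W \<longrightarrow> card W \<le> card V)"

text \<open>Injectivity is part of linear independence of an indexed family.\<close>

definition basis_family :: "('i \<Rightarrow> 'a::real_vector) \<Rightarrow> 'i set \<Rightarrow> 'a set \<Rightarrow> bool" where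
  "basis_family f I U \<longleftrightarrow> inj_on f I \<and> independent (f ` I) \<and> span (f ` I) = U"

end

theory Submission
  imports Defs
begin

text \<open>
  On \<open>Omega \<alpha>\<close> the sum \<open>u + v + w\<close> is the constant \<open>\<alpha>\<close>, so adding the same integer to all three
  frequencies of a wave only shifts its phase by a constant. Modulo this shift, the frequencies
  \<open>(r, g, b) \<in> {0..n}\<^sup>3\<close> become the pairs \<open>(p, q) = (r - b, g - b)\<close> that fill the lattice hexagon
  \<open>\<bar>p\<bar>, \<bar>q\<bar>, \<bar>p - q\<bar> \<le> n\<close>. The cosine and the sine of \<open>(p, q)\<close> and \<open>(- p, - q)\<close> together span at most two
  dimensions, and those of \<open>(0, 0)\<close> only the constants, so the dimension of the trigonometric space is at most the number
  \<open>3 n (n + 1) + 1\<close> of lattice points of the hexagon, which is also the size of the joint system.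
  Hence it is enough that the joint system lies in the trigonometric space and is independent
  (\<open>basis_familyI\<close>).

  Membership: multiplying by the sine or the cosine of half a variable moves the corresponding
  half-integral frequency by \<open>\<plusminus> 1/2\<close>. A product of half-angle factors of total degrees \<open>a, b, c\<close> in
  \<open>u, v, w\<close> therefore only has frequencies in a box; when \<open>a, b, c\<close> have the same parity and
  pairwise sums at most \<open>2 n\<close>, that box is carried into the hexagon by the shift
  (\<open>half_box_in_hexagon_space\<close>). All members of the joint system have such degrees.

  Independence: on the open edge \<open>v = 0\<close> the only surviving members are the \<open>R\<close> with \<open>j = 0\<close> and
  one \<open>G\<close>, and they restrict to the Bernstein-like products \<open>sin (u/2)^(2n-i) * sin (w/2)^i\<close>,
  \<open>0 \<le> i \<le> 2 n\<close>, which are independent. By rotation, the coefficients with \<open>j = 0\<close> vanish for all three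
  letters. What remains is \<open>sin (u/2) * sin (v/2) * sin (w/2)\<close> times a combination of the system of
  order \<open>n - 1\<close> (\<open>joint_Suc\<close>), and induction applies. Dividing by this factor is possible only in the
  interior of \<open>Omega \<alpha>\<close>, so the induction is over combinations that vanish in the interior;
  continuity brings them back to the edges.
\<close>

section \<open>Linear independence of the joint system\<close>

definition shell_index :: "nat \<Rightarrow> (nat \<times> nat) set" where
  "shell_index n = {(i, j). j < n \<and> j \<le> i \<and> i + j < 2 * n}"

definition joint :: "nat \<Rightarrow> (nat \<Rightarrow> nat \<Rightarrow> real) \<Rightarrow> (nat \<Rightarrow> nat \<Rightarrow> real) \<Rightarrow> (nat \<Rightarrow> nat \<Rightarrow> real)
    \<Rightarrow> real \<Rightarrow> trifun" where
  "joint n r g b d p =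
     (\<Sum>(i, j)\<in>shell_index n. r i j * Rfun n i j p + g i j * Gfun n i j p + b i j * Bfun n i j p)
     + d * Rfun n n n p"

lemma finite_shell_index [simp]: "finite (shell_index n)"
proof (rule finite_subset)
  show "shell_index n \<subseteq> {..<2*n} \<times> {..<n}"
    by (auto simp: shell_index_def)
qed simp

text \<open>
  Rotating the variables permutes the three letters cyclically and fixes the central function.
  This is why a combination is recorded with one coefficient table for each letter: a statement about
  the edge \<open>v = 0\<close> and the table \<open>r\<close> transfers to the other two edges and tables.
\<close>

lemma joint_rotate: "joint n r g b d (w, u, v) = joint n b r g d (u, v, w)"
  unfolding joint_def
  by (simp add: Gfun_def Bfun_def add_ac Rfun_def[of n n n] mult_ac)

lemma continuous_on_Rfun:
  assumes "continuous_on S x" "continuous_on S y" "continuous_on S z"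
  shows "continuous_on S (\<lambda>t. Rfun n i j (x t, y t, z t))"
proof -
  have sin: "continuous_on S (\<lambda>t. sin (f t / 2))" and cos: "continuous_on S (\<lambda>t. cos (f t / 2))"
    if "continuous_on S f" for f :: "'a \<Rightarrow> real"
    by (rule continuous_on_compose2[OF _ that, of UNIV "\<lambda>s. sin (s/2)"]
        continuous_on_compose2[OF _ that, of UNIV "\<lambda>s. cos (s/2)"];
        simp add: continuous_intros)+
  show ?thesis
    unfolding Rfun_def case_prod_conv
    by (cases "i \<le> n") (simp_all add: continuous_on_mult continuous_on_power sin cos assms)
qed

lemma continuous_on_joint:
  assumes "continuous_on S x" "continuous_on S y" "continuous_on S z"
  shows "continuous_on S (\<lambda>t. joint n r g b d (x t, y t, z t))"
  unfolding joint_def Gfun_def Bfun_def case_prod_unfold fst_conv snd_conv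
  by (intro continuous_on_add continuous_on_sum continuous_on_mult continuous_on_const
      continuous_on_Rfun assms)

text \<open>
  Every \<open>B\<close> contains a positive power of \<open>sin (v/2)\<close>, and so does every \<open>G\<close> other than the one with
  \<open>i = j = 0\<close>. That \<open>G\<close> restricts to \<open>sin (w/2)^(2n)\<close>, the product that is missing from the \<open>R\<close>.
\<close>

lemma joint_on_edge:
  assumes "1 \<le> n"
  shows "joint n r g b d (u, 0, w) =
    (\<Sum>i<2*n. r i 0 * (sin (u/2) ^ (2*n - i) * sin (w/2) ^ i)) + g 0 0 * sin (w/2) ^ (2*n)"
proof -
  have B: "Bfun n i j (u, 0, w) = 0" if "(i, j) \<in> shell_index n" for i j
    using that by (auto simp: Bfun_def Rfun_def shell_index_def)
  have G: "Gfun n i j (u, 0, w) = (if (i, j) = (0, 0) then sin (w/2) ^ (2*n) else 0)"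
    if "(i, j) \<in> shell_index n" for i j
    using that by (auto simp: Gfun_def Rfun_def shell_index_def)
  have R: "Rfun n i j (u, 0, w) = (if j = 0 then sin (u/2) ^ (2*n - i) * sin (w/2) ^ i else 0)"
    if "(i, j) \<in> shell_index n" for i j
    using that by (auto simp: Rfun_def shell_index_def)
  have "(\<Sum>(i, j)\<in>shell_index n. r i j * Rfun n i j (u, 0, w))
      = (\<Sum>(i, j)\<in>(\<lambda>i. (i, 0)) ` {..<2*n}. r i j * Rfun n i j (u, 0, w))"
    using assms by (intro sum.mono_neutral_right finite_shell_index)
      (auto simp: shell_index_def image_iff Rfun_def)
  also have "\<dots> = (\<Sum>i<2*n. r i 0 * Rfun n i 0 (u, 0, w))"
    by (subst sum.reindex) (auto simp: inj_on_def)
  also have "\<dots> = (\<Sum>i<2*n. r i 0 * (sin (u/2) ^ (2*n - i) * sin (w/2) ^ i))"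
    using assms by (intro sum.cong) (auto simp: R shell_index_def)
  finally have 1: "(\<Sum>(i, j)\<in>shell_index n. r i j * Rfun n i j (u, 0, w)) = \<dots>" .
  have "(\<Sum>(i, j)\<in>shell_index n. g i j * Gfun n i j (u, 0, w))
      = (\<Sum>k\<in>shell_index n. if k = (0, 0) then g 0 0 * sin (w/2) ^ (2*n) else 0)"
    by (intro sum.cong) (auto simp: G split: if_splits)
  also have "\<dots> = g 0 0 * sin (w/2) ^ (2*n)"
    using assms by (subst sum.delta[OF finite_shell_index]) (auto simp: shell_index_def)
  finally have 2: "(\<Sum>(i, j)\<in>shell_index n. g i j * Gfun n i j (u, 0, w)) = \<dots>" .
  have 3: "(\<Sum>(i, j)\<in>shell_index n. b i j * Bfun n i j (u, 0, w)) = 0"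
    by (intro sum.neutral) (auto simp: B)
  have "Rfun n n n (u, 0, w) = 0"
    using assms by (simp add: Rfun_def)
  then show ?thesis
    using 1 2 3 unfolding joint_def by (simp add: case_prod_unfold sum.distrib)
qed

text \<open>
  After division by \<open>sin (u/2)^m\<close> the combination is a polynomial in
  \<open>sin ((\<alpha> - u)/2) / sin (u/2) = sin (\<alpha>/2) * cot (u/2) - cos (\<alpha>/2)\<close>. This quotient is injective in \<open>u\<close>,
  so the polynomial has infinitely many zeros.
\<close>

lemma bernstein_sines_independent:
  assumes "0 < \<alpha>" "\<alpha> < pi"
    and zero: "\<And>u. 0 < u \<Longrightarrow> u < \<alpha> \<Longrightarrow>
      (\<Sum>i\<le>m. a i * (sin (u/2) ^ (m - i) * sin ((\<alpha> - u)/2) ^ i)) = 0"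
    and "i \<le> m"
  shows "a i = (0::real)"
proof (rule ccontr)
  assume "a i \<noteq> 0"
  define x where "x = (\<lambda>u. sin ((\<alpha> - u)/2) / sin (u/2))"
  have pos: "0 < sin (u/2)" if "u \<in> {0<..<\<alpha>}" for u
    using that assms by (intro sin_gt_zero) auto
  have "x ` {0<..<\<alpha>} \<subseteq> {z. (\<Sum>i\<le>m. a i * z ^ i) = 0}"
  proof clarify
    fix u assume u: "u \<in> {0<..<\<alpha>}"
    let ?s = "sin (u/2)" and ?t = "sin ((\<alpha> - u)/2)"
    have "?s ^ m * (\<Sum>i\<le>m. a i * x u ^ i) = (\<Sum>i\<le>m. a i * (?s ^ (m - i) * ?t ^ i))"
      unfolding sum_distrib_left x_def
    proof (intro sum.cong refl)
      fix k assume "k \<in> {..m}"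
      then have "?s ^ m = ?s ^ (m - k) * ?s ^ k"
        by (simp flip: power_add)
      then show "?s ^ m * (a k * (?t / ?s) ^ k) = a k * (?s ^ (m - k) * ?t ^ k)"
        using pos[OF u] by (simp add: power_divide)
    qed
    then show "(\<Sum>i\<le>m. a i * x u ^ i) = 0"
      using zero[of u] u pos[OF u] by simp
  qed
  moreover have "finite {z. (\<Sum>i\<le>m. a i * z ^ i) = 0}"
    using polyfun_finite_roots[of a m] \<open>i \<le> m\<close> \<open>a i \<noteq> 0\<close> by blast
  ultimately have "finite (x ` {0<..<\<alpha>})"
    using finite_subset by blast
  moreover have "inj_on x {0<..<\<alpha>}"
  proof (rule inj_onI)
    fix u v assume u: "u \<in> {0<..<\<alpha>}" and v: "v \<in> {0<..<\<alpha>}" and eq: "x u = x v"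
    have "sin ((\<alpha> - u)/2) * sin (v/2) = sin ((\<alpha> - v)/2) * sin (u/2)"
      using eq pos[OF u] pos[OF v] by (simp add: x_def field_simps)
    then have "sin (\<alpha>/2) * sin ((v - u)/2) = 0"
      by (simp add: diff_divide_distrib sin_diff algebra_simps)
    moreover have "sin (\<alpha>/2) > 0"
      using assms by (intro sin_gt_zero) auto
    ultimately have "sin ((v - u)/2) = 0"
      by simp
    then show "u = v"
      using sin_zero_iff_int2[of "(v - u)/2"] sin_eq_0_pi[of "(v - u)/2"] u v assms by auto
  qed
  ultimately have "finite {0<..<\<alpha>}"
    using finite_image_iff by blast
  then show False
    using assms by (simp add: infinite_Ioo)
qed

lemma edge_coefficients_zero:
  assumes "0 < \<alpha>" "\<alpha> < pi" "1 \<le> n"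
    and zero: "\<And>u v w. 0 < u \<Longrightarrow> 0 < v \<Longrightarrow> 0 < w \<Longrightarrow> u + v + w = \<alpha> \<Longrightarrow>
      joint n r g b d (u, v, w) = 0"
    and "i < 2 * n"
  shows "r i 0 = 0"
proof -
  have edge: "joint n r g b d (u, 0, \<alpha> - u) = 0" if u: "0 < u" "u < \<alpha>" for u
  proof -
    define F where "F = (\<lambda>v. joint n r g b d (u, v, \<alpha> - u - v))"
    have "continuous_on UNIV F"
      unfolding F_def by (intro continuous_on_joint continuous_intros)
    then have "(F \<longlongrightarrow> F 0) (at_right 0)"
      by (simp add: continuous_on_eq_continuous_at isCont_def filterlim_at_split)
    moreover have "eventually (\<lambda>v. F v = 0) (at_right 0)"
      unfolding eventually_at_right_field F_def
      using u by (intro exI[of _ "\<alpha> - u"]) (auto intro!: zero)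
    then have "(F \<longlongrightarrow> 0) (at_right 0)"
      by (rule tendsto_eventually)
    ultimately have "F 0 = 0"
      using tendsto_unique[of "at_right (0::real)" F] by auto
    then show ?thesis
      by (simp add: F_def)
  qed
  (* the coefficients on the edge: the table r, completed at index 2n by the single G *)
  define a where "a = (\<lambda>i. if i = 2 * n then g 0 0 else r i 0)"
  have "a i = 0"
  proof (rule bernstein_sines_independent[OF assms(1,2)])
    fix u assume u: "0 < u" "u < \<alpha>"
    have "(\<Sum>i\<le>2*n. a i * (sin (u/2) ^ (2*n - i) * sin ((\<alpha> - u)/2) ^ i))
      = joint n r g b d (u, 0, \<alpha> - u)"
      unfolding joint_on_edge[OF \<open>1 \<le> n\<close>] lessThan_Suc_atMost[symmetric]
      by (simp add: a_def)
    then show "(\<Sum>i\<le>2*n. a i * (sin (u/2) ^ (2*n - i) * sin ((\<alpha> - u)/2) ^ i)) = 0"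
      using edge[OF u] by simp
  qed (use \<open>i < 2 * n\<close> in simp)
  then show ?thesis
    using \<open>i < 2 * n\<close> by (simp add: a_def)
qed

lemma Rfun_Suc:
  assumes "i + j \<le> 2 * n"
  shows "Rfun (Suc n) (Suc i) (Suc j) (u, v, w) = sin (u/2) * sin (v/2) * sin (w/2) * Rfun n i j (u, v, w)"
proof -
  have "2 * Suc n - Suc i = Suc (2 * n - i)" "2 * Suc n - Suc i - Suc j = 2 * n - i - j"
    using assms by auto
  then show ?thesis
    by (simp add: Rfun_def)
qed

text \<open>
  Once the outermost shell \<open>j = 0\<close> is gone, every remaining function has the common factor
  \<open>sin (u/2) * sin (v/2) * sin (w/2)\<close>, and removing it lowers \<open>n\<close>, \<open>i\<close> and \<open>j\<close> by one.
\<close>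

lemma joint_Suc:
  assumes "\<And>i. i < 2 * Suc n \<Longrightarrow> r i 0 = 0" "\<And>i. i < 2 * Suc n \<Longrightarrow> g i 0 = 0"
    "\<And>i. i < 2 * Suc n \<Longrightarrow> b i 0 = 0"
  shows "joint (Suc n) r g b d (u, v, w) = sin (u/2) * sin (v/2) * sin (w/2) *
    joint n (\<lambda>i j. r (Suc i) (Suc j)) (\<lambda>i j. g (Suc i) (Suc j)) (\<lambda>i j. b (Suc i) (Suc j)) d (u, v, w)"
    (is "_ = ?s * _")
proof -
  let ?f = "\<lambda>i j. r i j * Rfun (Suc n) i j (u, v, w) + g i j * Gfun (Suc n) i j (u, v, w)
    + b i j * Bfun (Suc n) i j (u, v, w)"
  have "(\<Sum>(i, j)\<in>shell_index (Suc n). ?f i j) = (\<Sum>(i, j)\<in>map_prod Suc Suc ` shell_index n. ?f i j)"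
  proof (intro sum.mono_neutral_right finite_shell_index ballI)
    fix k assume k: "k \<in> shell_index (Suc n) - map_prod Suc Suc ` shell_index n"
    obtain i j where ij: "k = (i, j)"
      by (cases k)
    have "j = 0"
    proof (rule ccontr)
      assume "j \<noteq> 0"
      then have "(i, j) = map_prod Suc Suc (i - 1, j - 1)" "(i - 1, j - 1) \<in> shell_index n"
        using k ij by (auto simp: shell_index_def)
      then show False
        using k ij by (metis DiffD2 image_eqI)
    qed
    then show "(case k of (i, j) \<Rightarrow> ?f i j) = 0"
      using k assms ij by (simp add: shell_index_def)
  qed (auto simp: shell_index_def)
  also have "\<dots> = (\<Sum>(i, j)\<in>shell_index n. ?f (Suc i) (Suc j))"
    by (subst sum.reindex) (auto simp: inj_on_def case_prod_unfold)
  also have "\<dots> = (\<Sum>(i, j)\<in>shell_index n. ?s * (r (Suc i) (Suc j) * Rfun n i j (u, v, w)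
     + g (Suc i) (Suc j) * Gfun n i j (u, v, w) + b (Suc i) (Suc j) * Bfun n i j (u, v, w)))"
    by (intro sum.cong) (auto simp: shell_index_def Gfun_def Bfun_def Rfun_Suc algebra_simps)
  finally show ?thesis
    unfolding joint_def by (simp add: Rfun_Suc sum_distrib_left distrib_left case_prod_unfold mult_ac)
qed

lemma joint_coefficients_zero:
  assumes "0 < \<alpha>" "\<alpha> < pi"
    and "\<And>u v w. 0 < u \<Longrightarrow> 0 < v \<Longrightarrow> 0 < w \<Longrightarrow> u + v + w = \<alpha> \<Longrightarrow>
      joint n r g b d (u, v, w) = 0"
  shows "d = 0 \<and> (\<forall>(i, j)\<in>shell_index n. r i j = 0 \<and> g i j = 0 \<and> b i j = 0)"
  using assms(3)
proof (induction n arbitrary: r g b)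
  case 0
  have "joint 0 r g b d (\<alpha>/3, \<alpha>/3, \<alpha>/3) = 0"
    using \<open>0 < \<alpha>\<close> by (intro "0.prems") auto
  then show ?case
    by (simp add: joint_def shell_index_def Rfun_def)
next
  case (Suc n)
  have zero: "joint (Suc n) g b r d (u, v, w) = 0" "joint (Suc n) b r g d (u, v, w) = 0"
    if "0 < u" "0 < v" "0 < w" "u + v + w = \<alpha>" for u v w
    using that Suc.prems[of v w u] Suc.prems[of w u v]
      joint_rotate[of "Suc n" r g b d w u v] joint_rotate[of "Suc n" g b r d u v w]
    by (simp_all add: joint_rotate)
  have r: "r i 0 = 0" if "i < 2 * Suc n" for i
    by (rule edge_coefficients_zero[OF assms(1,2) _ Suc.prems that]) auto
  have g: "g i 0 = 0" if "i < 2 * Suc n" for i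
    by (rule edge_coefficients_zero[OF assms(1,2) _ zero(1) that]) auto
  have b: "b i 0 = 0" if "i < 2 * Suc n" for i
    by (rule edge_coefficients_zero[OF assms(1,2) _ zero(2) that]) auto
  have IH: "d = 0 \<and> (\<forall>(i, j)\<in>shell_index n. r (Suc i) (Suc j) = 0 \<and> g (Suc i) (Suc j) = 0
      \<and> b (Suc i) (Suc j) = 0)"
  proof (rule Suc.IH)
    fix u v w :: real assume uvw: "0 < u" "0 < v" "0 < w" "u + v + w = \<alpha>"
    then have "sin (u/2) > 0" "sin (v/2) > 0" "sin (w/2) > 0"
      using \<open>\<alpha> < pi\<close> by (auto intro!: sin_gt_zero)
    then show "joint n (\<lambda>i j. r (Suc i) (Suc j)) (\<lambda>i j. g (Suc i) (Suc j))
        (\<lambda>i j. b (Suc i) (Suc j)) d (u, v, w) = 0"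
      using Suc.prems[OF uvw] joint_Suc[of n r g b d u v w, OF r g b] by simp
  qed
  show ?case
  proof (intro conjI ballI)
    fix k assume k: "k \<in> shell_index (Suc n)"
    obtain i j where ij: "k = (i, j)"
      by (cases k)
    show "case k of (i, j) \<Rightarrow> r i j = 0 \<and> g i j = 0 \<and> b i j = 0"
    proof (cases j)
      case 0
      then show ?thesis
        using k r g b by (simp add: ij shell_index_def)
    next
      case (Suc j')
      then obtain i' where "i = Suc i'"
        using k by (cases i) (auto simp: ij shell_index_def)
      moreover have "(i', j') \<in> shell_index n"
        using k Suc calculation by (auto simp: ij shell_index_def)
      ultimately show ?thesis
        using IH Suc ij by auto
    qed
  qed (use IH in simp)
qed

section \<open>Spanning by counting\<close>

lemma sum_apply: "(\<Sum>i\<in>A. f i) x = (\<Sum>i\<in>A. f i x)"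
  for f :: "'i \<Rightarrow> 'a \<Rightarrow> 'b::comm_monoid_add"
  by (induction A rule: infinite_finite_induct) auto

text \<open>
  A vector of \<open>T\<close> outside \<open>span S\<close> could be added to \<open>S\<close>, and the result would be an independent set in
  \<open>span T\<close> with more than \<open>card T\<close> elements.
\<close>

lemma span_eqI_card:
  assumes "finite T" "independent S" "S \<subseteq> span T" "card T \<le> card S"
  shows "span S = span T"
proof
  show "span S \<subseteq> span T"
    using assms(3) by (simp add: span_minimal)
  have "T \<subseteq> span S"
  proof
    fix x assume "x \<in> T"
    show "x \<in> span S"
    proof (rule ccontr)
      assume x: "x \<notin> span S"
      then have "independent (insert x S)"
        using assms(2) by (simp add: independent_insert)
      moreover have "insert x S \<subseteq> span T"
        using \<open>x \<in> T\<close> assms(3) by (simp add: span_base)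
      ultimately have "finite (insert x S) \<and> card (insert x S) \<le> card T"
        by (rule independent_span_bound[OF assms(1)])
      moreover have "x \<notin> S"
        using x span_base by blast
      ultimately show False
        using assms(4) by auto
    qed
  qed
  then show "span T \<subseteq> span S"
    by (simp add: span_minimal)
qed

lemma span_largest_independent_subset:
  assumes "finite S" "largest_independent_subset V S"
  shows "span V = span S"
proof -
  obtain B where B: "B \<subseteq> S" "independent B" "S \<subseteq> span B"
    by (metis maximal_independent_subset)
  have V: "V \<subseteq> S" "independent V" "card B \<le> card V"
    using assms(2) B by (auto simp: largest_independent_subset_def)
  have "span B = span S"
    using B by (metis span_mono span_minimal subspace_span subset_antisym)
  moreover have "span V = span B"
    using B V assms(1) by (intro span_eqI_card) (auto intro: finite_subset)
  ultimately show ?thesis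
    by simp
qed

lemma basis_familyI:
  fixes f :: "'i \<Rightarrow> 'a::real_vector"
  assumes "finite I"
    and "\<And>c k. (\<Sum>k\<in>I. c k *\<^sub>R f k) = 0 \<Longrightarrow> k \<in> I \<Longrightarrow> c k = 0"
    and "finite T" "f ` I \<subseteq> span T" "card T \<le> card I"
  shows "basis_family f I (span T)"
proof -
  have inj: "inj_on f I"
  proof (rule inj_onI, rule ccontr)
    fix x y assume xy: "x \<in> I" "y \<in> I" "f x = f y" "x \<noteq> y"
    define c :: "'i \<Rightarrow> real" where "c = (\<lambda>k. if k = x then 1 else if k = y then -1 else 0)"
    have "(\<Sum>k\<in>I. c k *\<^sub>R f k) = (\<Sum>k\<in>{x, y}. c k *\<^sub>R f k)"
      using xy assms(1) by (intro sum.mono_neutral_right) (auto simp: c_def)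
    also have "\<dots> = 0"
      using xy by (simp add: c_def)
    finally show False
      using assms(2)[of c x] xy by (simp add: c_def)
  qed
  moreover have ind: "independent (f ` I)"
  proof (rule independent_if_scalars_zero)
    fix c x assume "(\<Sum>x\<in>f ` I. c x *\<^sub>R x) = 0" "x \<in> f ` I"
    then show "c x = 0"
      using assms(2)[of "c \<circ> f"] inj by (auto simp: sum.reindex)
  qed (use assms(1) in simp)
  moreover have "span (f ` I) = span T"
    using assms ind inj by (intro span_eqI_card) (auto simp: card_image)
  ultimately show ?thesis
    by (simp add: basis_family_def)
qed

section \<open>Waves on the triangle\<close>

text \<open>
  The frequencies are measured in units of one half, so that \<open>sin (u/2)\<close> is the wave of frequency
  \<open>(1, 0, 0)\<close> and \<open>cos (r u + g v + b w)\<close> that of frequency \<open>(2 r, 2 g, 2 b)\<close>.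
\<close>

definition phase :: "int \<times> int \<times> int \<Rightarrow> trifun" where
  "phase = (\<lambda>(x, y, z) (u, v, w). (of_int x * u + of_int y * v + of_int z * w) / 2)"

definition cosine_wave :: "real \<Rightarrow> int \<times> int \<times> int \<Rightarrow> trifun" where
  "cosine_wave \<alpha> k = on_Omega \<alpha> (\<lambda>p. cos (phase k p))"

definition sine_wave :: "real \<Rightarrow> int \<times> int \<times> int \<Rightarrow> trifun" where
  "sine_wave \<alpha> k = on_Omega \<alpha> (\<lambda>p. sin (phase k p))"

definition wave_space :: "real \<Rightarrow> (int \<times> int \<times> int) set \<Rightarrow> trifun set" where
  "wave_space \<alpha> S = span (cosine_wave \<alpha> ` S \<union> sine_wave \<alpha> ` S)"

lemma phase_add: "phase (k + l) p = phase k p + phase l p"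
  by (cases k; cases l; cases p) (simp add: phase_def field_simps)

lemma phase_diff: "phase (k - l) p = phase k p - phase l p"
  by (cases k; cases l; cases p) (simp add: phase_def field_simps)

lemma phase_eq_on_Omega:
  assumes "p \<in> Omega \<alpha>"
  shows "phase (x, y, z) p = phase (x + m, y + m, z + m) p - of_int m * \<alpha> / 2"
proof -
  obtain u v w where p: "p = (u, v, w)"
    by (cases p)
  have "\<alpha> = u + v + w"
    using assms by (simp add: p Omega_def)
  then show ?thesis
    by (simp add: p phase_def field_simps)
qed

lemma waves_in_wave_space:
  assumes "k \<in> S"
  shows "cosine_wave \<alpha> k \<in> wave_space \<alpha> S" "sine_wave \<alpha> k \<in> wave_space \<alpha> S"
  using assms by (auto simp: wave_space_def intro: span_base)

lemma wave_space_subset_span: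
  assumes "\<And>k. k \<in> S \<Longrightarrow> cosine_wave \<alpha> k \<in> span X" "\<And>k. k \<in> S \<Longrightarrow> sine_wave \<alpha> k \<in> span X"
  shows "wave_space \<alpha> S \<subseteq> span X"
  unfolding wave_space_def using assms by (intro span_minimal) auto

lemma wave_space_combination:
  assumes "k \<in> S" "\<And>p. p \<in> Omega \<alpha> \<Longrightarrow> f p = a * cos (phase k p) + b * sin (phase k p)"
  shows "on_Omega \<alpha> f \<in> wave_space \<alpha> S"
proof -
  have "on_Omega \<alpha> f = a *\<^sub>R cosine_wave \<alpha> k + b *\<^sub>R sine_wave \<alpha> k"
    using assms(2) by (auto simp: on_Omega_def cosine_wave_def sine_wave_def scaleR_fun_def)
  then show ?thesis
    using waves_in_wave_space[OF assms(1)]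
    by (simp add: wave_space_def span_add span_scale)
qed

text \<open>
  Moving a frequency along the diagonal changes the phase by a constant on \<open>Omega \<alpha>\<close>, and the
  addition formulas express the wave by the cosine and sine of the moved frequency.
\<close>

lemma wave_space_translate:
  assumes "\<And>x y z. (x, y, z) \<in> S \<Longrightarrow> \<exists>m. (x + m, y + m, z + m) \<in> S'"
  shows "wave_space \<alpha> S \<subseteq> wave_space \<alpha> S'"
  unfolding wave_space_def[of \<alpha> S']
proof (rule wave_space_subset_span)
  fix k assume "k \<in> S"
  obtain x y z where k: "k = (x, y, z)"
    by (cases k)
  obtain m where m: "(x + m, y + m, z + m) \<in> S'"
    using assms \<open>k \<in> S\<close> k by blast
  let ?t = "of_int m * \<alpha> / 2"
  have "cosine_wave \<alpha> k \<in> wave_space \<alpha> S'"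
    unfolding cosine_wave_def
    by (rule wave_space_combination[OF m, of _ _ "cos ?t" "sin ?t"])
       (simp add: k phase_eq_on_Omega[of _ \<alpha> x y z m] cos_diff)
  moreover have "sine_wave \<alpha> k \<in> wave_space \<alpha> S'"
    unfolding sine_wave_def
    by (rule wave_space_combination[OF m, of _ _ "- sin ?t" "cos ?t"])
       (simp add: k phase_eq_on_Omega[of _ \<alpha> x y z m] sin_diff)
  ultimately show "cosine_wave \<alpha> k \<in> span (cosine_wave \<alpha> ` S' \<union> sine_wave \<alpha> ` S')"
    "sine_wave \<alpha> k \<in> span (cosine_wave \<alpha> ` S' \<union> sine_wave \<alpha> ` S')"
    by (simp_all add: wave_space_def)
qed

text \<open>
  The product-to-sum formulas turn the product with a wave of frequency \<open>e\<close> into waves whose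
  frequencies are moved by \<open>e\<close> and \<open>- e\<close>.
\<close>

lemma wave_space_mult:
  assumes S': "\<And>k. k \<in> S \<Longrightarrow> k + e \<in> S' \<and> k - e \<in> S'"
    and f: "on_Omega \<alpha> f \<in> wave_space \<alpha> S"
  shows "on_Omega \<alpha> (\<lambda>p. cos (phase e p) * f p) \<in> wave_space \<alpha> S'"
    and "on_Omega \<alpha> (\<lambda>p. sin (phase e p) * f p) \<in> wave_space \<alpha> S'"
proof -
  have sub: "subspace (wave_space \<alpha> S')"
    by (simp add: wave_space_def)
  let ?P = "\<lambda>F. (\<lambda>p. cos (phase e p) * F p) \<in> wave_space \<alpha> S'
    \<and> (\<lambda>p. sin (phase e p) * F p) \<in> wave_space \<alpha> S'"
  have *: "?P F" if "F \<in> wave_space \<alpha> S" for F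
    using that unfolding wave_space_def[of \<alpha> S]
  proof (induction rule: span_induct_alt)
    case base
    then show ?case
      using subspace_0[OF sub] by (simp add: zero_fun_def)
  next
    case (step c g h)
    have "(\<lambda>p. q p * (c *\<^sub>R g + h) p) = c *\<^sub>R (\<lambda>p. q p * g p) + (\<lambda>p. q p * h p)" for q :: trifun
      by (simp add: fun_eq_iff scaleR_fun_def algebra_simps)
    moreover have "?P g"
    proof -
      obtain k where k: "k \<in> S" "g = cosine_wave \<alpha> k \<or> g = sine_wave \<alpha> k"
        using step by auto
      have kk: "cosine_wave \<alpha> (k + e) \<in> wave_space \<alpha> S'" "cosine_wave \<alpha> (k - e) \<in> wave_space \<alpha> S'"
        "sine_wave \<alpha> (k + e) \<in> wave_space \<alpha> S'" "sine_wave \<alpha> (k - e) \<in> wave_space \<alpha> S'"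
        using S'[OF k(1)] by (simp_all add: waves_in_wave_space)
      have cc: "(\<lambda>p. cos (phase e p) * cosine_wave \<alpha> k p)
          = (1/2) *\<^sub>R (cosine_wave \<alpha> (k + e) + cosine_wave \<alpha> (k - e))"
        by (auto simp: fun_eq_iff scaleR_fun_def cosine_wave_def on_Omega_def phase_add phase_diff
            cos_add cos_diff)
      have sc: "(\<lambda>p. sin (phase e p) * cosine_wave \<alpha> k p)
          = (1/2) *\<^sub>R (sine_wave \<alpha> (k + e) - sine_wave \<alpha> (k - e))"
        by (auto simp: fun_eq_iff scaleR_fun_def cosine_wave_def sine_wave_def on_Omega_def
            phase_add phase_diff sin_add sin_diff)
      have cs: "(\<lambda>p. cos (phase e p) * sine_wave \<alpha> k p)
          = (1/2) *\<^sub>R (sine_wave \<alpha> (k + e) + sine_wave \<alpha> (k - e))"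
        by (auto simp: fun_eq_iff scaleR_fun_def sine_wave_def on_Omega_def
            phase_add phase_diff sin_add sin_diff)
      have ss: "(\<lambda>p. sin (phase e p) * sine_wave \<alpha> k p)
          = (1/2) *\<^sub>R (cosine_wave \<alpha> (k - e) - cosine_wave \<alpha> (k + e))"
        by (auto simp: fun_eq_iff scaleR_fun_def cosine_wave_def sine_wave_def on_Omega_def
            phase_add phase_diff cos_add cos_diff)
      show ?thesis
        using k(2) kk
        by (auto simp: cc sc cs ss intro!: subspace_scale[OF sub] subspace_add[OF sub] subspace_diff[OF sub])
    qed
    ultimately show ?case
      using step by (auto intro!: subspace_scale[OF sub] subspace_add[OF sub])
  qed
  have eq: "on_Omega \<alpha> (\<lambda>p. q p * f p) = (\<lambda>p. q p * on_Omega \<alpha> f p)" for q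
    by (auto simp: on_Omega_def)
  show "on_Omega \<alpha> (\<lambda>p. cos (phase e p) * f p) \<in> wave_space \<alpha> S'"
    "on_Omega \<alpha> (\<lambda>p. sin (phase e p) * f p) \<in> wave_space \<alpha> S'"
    unfolding eq using *[OF f] by auto
qed

text \<open>
  The family \<open>S\<close> of frequency sets grows with the number of factors already multiplied in.
\<close>

lemma wave_space_mult_powers:
  assumes S: "\<And>m k. k \<in> S m \<Longrightarrow> k + e \<in> S (Suc m) \<and> k - e \<in> S (Suc m)"
    and f: "on_Omega \<alpha> f \<in> wave_space \<alpha> (S 0)"
  shows "on_Omega \<alpha> (\<lambda>p. sin (phase e p) ^ a * cos (phase e p) ^ b * f p) \<in> wave_space \<alpha> (S (a + b))"
proof (induction a)
  case 0
  show ?case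
  proof (induction b)
    case (Suc b)
    then have "on_Omega \<alpha> (\<lambda>p. cos (phase e p) ^ b * f p) \<in> wave_space \<alpha> (S b)"
      by simp
    from wave_space_mult(1)[OF S this] show ?case
      by (simp add: mult_ac)
  qed (use f in simp)
next
  case (Suc a)
  from wave_space_mult(2)[OF S Suc] show ?case
    by (simp add: mult_ac)
qed

text \<open>
  The frequencies that occur in a product of \<open>a\<close>, \<open>b\<close> and \<open>c\<close> sines and cosines of \<open>u/2\<close>, \<open>v/2\<close> and
  \<open>w/2\<close>: each factor contributes \<open>1\<close> or \<open>- 1\<close>, which also fixes the parities.
\<close>

definition half_box :: "nat \<Rightarrow> nat \<Rightarrow> nat \<Rightarrow> (int \<times> int \<times> int) set" where
  "half_box a b c = {(x, y, z). \<bar>x\<bar> \<le> int a \<and> even (x - int a) \<and> \<bar>y\<bar> \<le> int b \<and> even (y - int b)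
     \<and> \<bar>z\<bar> \<le> int c \<and> even (z - int c)}"

lemma half_box_step:
  assumes "(x, y, z) \<in> half_box a b c"
  shows "(x + 1, y, z) \<in> half_box (Suc a) b c \<and> (x - 1, y, z) \<in> half_box (Suc a) b c"
    and "(x, y + 1, z) \<in> half_box a (Suc b) c \<and> (x, y - 1, z) \<in> half_box a (Suc b) c"
    and "(x, y, z + 1) \<in> half_box a b (Suc c) \<and> (x, y, z - 1) \<in> half_box a b (Suc c)"
proof -
  have *: "\<bar>t + 1\<bar> \<le> int (Suc m) \<and> even (t + 1 - int (Suc m)) \<and>
      \<bar>t - 1\<bar> \<le> int (Suc m) \<and> even (t - 1 - int (Suc m))"
    if "\<bar>t\<bar> \<le> int m" "even (t - int m)" for t m
    using that by presburger
  show "(x + 1, y, z) \<in> half_box (Suc a) b c \<and> (x - 1, y, z) \<in> half_box (Suc a) b c"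
    "(x, y + 1, z) \<in> half_box a (Suc b) c \<and> (x, y - 1, z) \<in> half_box a (Suc b) c"
    "(x, y, z + 1) \<in> half_box a b (Suc c) \<and> (x, y, z - 1) \<in> half_box a b (Suc c)"
    using assms *[of x a] *[of y b] *[of z c] unfolding half_box_def mem_Collect_eq case_prod_conv
    by blast+
qed

lemma half_angle_monomial_in_wave_space:
  "on_Omega \<alpha> (\<lambda>(u, v, w). sin (u/2) ^ a * cos (u/2) ^ a' * (sin (v/2) ^ b * cos (v/2) ^ b' *
     (sin (w/2) ^ c * cos (w/2) ^ c'))) \<in> wave_space \<alpha> (half_box (a + a') (b + b') (c + c'))"
proof -
  have "on_Omega \<alpha> (\<lambda>_. 1) \<in> wave_space \<alpha> (half_box 0 0 0)"
    by (rule wave_space_combination[of "(0, 0, 0)" _ _ _ 1 0]) (auto simp: half_box_def phase_def)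
  then have "on_Omega \<alpha> (\<lambda>p. sin (phase (0, 0, 1) p) ^ c * cos (phase (0, 0, 1) p) ^ c' * 1)
      \<in> wave_space \<alpha> (half_box 0 0 (c + c'))"
    by (rule wave_space_mult_powers[where S = "half_box 0 0", rotated]) (auto simp: half_box_step)
  then have "on_Omega \<alpha> (\<lambda>p. sin (phase (0, 1, 0) p) ^ b * cos (phase (0, 1, 0) p) ^ b' *
      (sin (phase (0, 0, 1) p) ^ c * cos (phase (0, 0, 1) p) ^ c' * 1))
      \<in> wave_space \<alpha> (half_box 0 (b + b') (c + c'))"
    by (rule wave_space_mult_powers[where S = "\<lambda>m. half_box 0 m (c + c')", rotated])
       (auto simp: half_box_step)
  then have "on_Omega \<alpha> (\<lambda>p. sin (phase (1, 0, 0) p) ^ a * cos (phase (1, 0, 0) p) ^ a' *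
      (sin (phase (0, 1, 0) p) ^ b * cos (phase (0, 1, 0) p) ^ b' *
      (sin (phase (0, 0, 1) p) ^ c * cos (phase (0, 0, 1) p) ^ c' * 1)))
      \<in> wave_space \<alpha> (half_box (a + a') (b + b') (c + c'))"
    by (rule wave_space_mult_powers[where S = "\<lambda>m. half_box m (b + b') (c + c')", rotated])
       (auto simp: half_box_step)
  then show ?thesis
    by (simp add: phase_def case_prod_unfold)
qed

section \<open>The hexagon of frequencies\<close>

definition hexagon :: "nat \<Rightarrow> (int \<times> int) set" where
  "hexagon n = {(p, q). \<bar>p\<bar> \<le> int n \<and> \<bar>q\<bar> \<le> int n \<and> \<bar>p - q\<bar> \<le> int n}"

definition hexagon_space :: "real \<Rightarrow> nat \<Rightarrow> trifun set" where
  "hexagon_space \<alpha> n = wave_space \<alpha> ((\<lambda>(p, q). (2 * p, 2 * q, 0)) ` hexagon n)"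

text \<open>
  Translating the third frequency to zero turns \<open>(x, y, z)\<close> into \<open>(x - z, y - z, 0)\<close>. The parity
  conditions make these differences even, and each of the three bounds on \<open>a, b, c\<close> gives one of the
  three inequalities of the hexagon.
\<close>

lemma half_box_in_hexagon_space:
  assumes "a + b \<le> 2 * n" "b + c \<le> 2 * n" "a + c \<le> 2 * n" "even (a + c)" "even (b + c)"
  shows "wave_space \<alpha> (half_box a b c) \<subseteq> hexagon_space \<alpha> n"
  unfolding hexagon_space_def
proof (rule wave_space_translate)
  fix x y z assume *: "(x, y, z) \<in> half_box a b c"
  then have "even (x - z)" "even (y - z)"
    using assms(4,5) by (auto simp: half_box_def)
  then obtain p q where pq: "x - z = 2 * p" "y - z = 2 * q"
    using even_two_times_div_two by metis
  have "(p, q) \<in> hexagon n"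
    using * assms(1-3) pq unfolding hexagon_def half_box_def by auto
  then show "\<exists>m. (x + m, y + m, z + m) \<in> (\<lambda>(p, q). (2 * p, 2 * q, 0)) ` hexagon n"
    using pq by (intro exI[of _ "- z"]) (auto simp: image_iff intro!: bexI[of _ "(p, q)"])
qed

lemma half_angle_monomial_in_hexagon_space:
  assumes "a + a' + (b + b') \<le> 2 * n" "b + b' + (c + c') \<le> 2 * n" "a + a' + (c + c') \<le> 2 * n"
    "even (a + a' + (c + c'))" "even (b + b' + (c + c'))"
    "\<And>u v w. f (u, v, w) = sin (u/2) ^ a * cos (u/2) ^ a' * (sin (v/2) ^ b * cos (v/2) ^ b' *
     (sin (w/2) ^ c * cos (w/2) ^ c'))"
  shows "on_Omega \<alpha> f \<in> hexagon_space \<alpha> n"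
proof -
  have "f = (\<lambda>(u, v, w). sin (u/2) ^ a * cos (u/2) ^ a' * (sin (v/2) ^ b * cos (v/2) ^ b' *
     (sin (w/2) ^ c * cos (w/2) ^ c')))"
    using assms(6) by auto
  then show ?thesis
    using half_angle_monomial_in_wave_space half_box_in_hexagon_space[OF assms(1-5)] by blast
qed

text \<open>
  The degrees of \<open>R\<close> are \<open>2 n - i\<close> in \<open>u\<close>, \<open>i\<close> in \<open>w\<close>, and the smaller of these two in \<open>v\<close>. The
  exponent of \<open>cos (v/2)\<close> is chosen exactly for that.
\<close>

lemma T_fun_in_hexagon_space:
  assumes "j \<le> i" "i + j \<le> 2 * n"
  shows "T_fun \<alpha> n (l, i, j) \<in> hexagon_space \<alpha> n"
proof -
  (* the total degree in the middle variable *)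
  define m where "m = (if i \<le> n then i else 2 * n - i)"
  have R: "Rfun n i j (u, v, w) = sin (u/2) ^ (2 * n - i) * sin (w/2) ^ i * cos (v/2) ^ (m - j) * sin (v/2) ^ j"
    for u v w by (simp add: Rfun_def m_def)
  have m: "j \<le> m" "m + (2 * n - i) \<le> 2 * n" "m + i \<le> 2 * n" "i \<le> 2 * n" "even (m + i)"
    using assms by (auto simp: m_def)
  have e: "even (2 * n - i + i)" "even (2 * n - i + m)"
    using m by (auto simp: m_def)
  show ?thesis
  proof (cases l)
    case Red
    then show ?thesis
      using m e
      by (auto simp: R mult_ac add_ac
          intro!: half_angle_monomial_in_hexagon_space[of "2*n-i" 0 j "m-j" n i 0])
  next
    case Green
    then show ?thesis
      using m e
      by (auto simp: R Gfun_def mult_ac add_ac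
          intro!: half_angle_monomial_in_hexagon_space[of j "m-j" i 0 n "2*n-i" 0])
  next
    case Blue
    then show ?thesis
      using m e
      by (auto simp: R Bfun_def mult_ac add_ac
          intro!: half_angle_monomial_in_hexagon_space[of i 0 "2*n-i" 0 n j "m-j"])
  qed
qed

lemma trig_system_eq_waves:
  "trig_system \<alpha> n = (\<Union>r\<in>{0..n}. \<Union>g\<in>{0..n}. \<Union>b\<in>{0..n}.
     {cosine_wave \<alpha> (2 * int r, 2 * int g, 2 * int b), sine_wave \<alpha> (2 * int r, 2 * int g, 2 * int b)})"
proof -
  have *: "(\<lambda>(u, v, w). h (real r * u + real g * v + real b * w))
      = (\<lambda>p. h (phase (2 * int r, 2 * int g, 2 * int b) p))" for h :: "real \<Rightarrow> real" and r g b
    by (simp add: phase_def fun_eq_iff add_divide_distrib)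
  show ?thesis
    by (simp only: trig_system_def cosine_wave_def sine_wave_def *)
qed

lemma span_trig_system: "span (trig_system \<alpha> n) = hexagon_space \<alpha> n"
proof -
  let ?K = "\<Union>r\<in>{0..n}. \<Union>g\<in>{0..n}. \<Union>b\<in>{0..n}. {(2 * int r, 2 * int g, 2 * int b)}"
  have "trig_system \<alpha> n = cosine_wave \<alpha> ` ?K \<union> sine_wave \<alpha> ` ?K"
    unfolding trig_system_eq_waves by blast
  then have "span (trig_system \<alpha> n) = wave_space \<alpha> ?K"
    by (simp add: wave_space_def)
  also have "\<dots> = hexagon_space \<alpha> n"
    unfolding hexagon_space_def
  proof (intro subset_antisym wave_space_translate)
    fix x y z assume "(x, y, z) \<in> ?K"
    then obtain r g b where rgb: "r \<le> n" "g \<le> n" "b \<le> n" "(x, y, z) = (2 * int r, 2 * int g, 2 * int b)"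
      by auto
    then show "\<exists>m. (x + m, y + m, z + m) \<in> (\<lambda>(p, q). (2 * p, 2 * q, 0)) ` hexagon n"
      by (intro exI[of _ "- z"] image_eqI[of _ _ "(int r - int b, int g - int b)"])
         (auto simp: hexagon_def)
  next
    fix x y z assume "(x, y, z) \<in> (\<lambda>(p, q). (2 * p, 2 * q, 0 :: int)) ` hexagon n"
    then obtain p q where pq: "(p, q) \<in> hexagon n" "x = 2 * p" "y = 2 * q" "z = 0"
      by auto
    (* the least shift b that makes p + b, q + b and b all non-negative *)
    define b where "b = max 0 (max (- p) (- q))"
    have "0 \<le> b" "b \<le> int n" "0 \<le> p + b" "p + b \<le> int n" "0 \<le> q + b" "q + b \<le> int n"
      using pq(1) by (auto simp: hexagon_def b_def)
    then show "\<exists>m. (x + m, y + m, z + m) \<in> ?K"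
      using pq(2-4)
      by (intro exI[of _ "2 * b"] UN_I[of "nat (p + b)"] UN_I[of "nat (q + b)"] UN_I[of "nat b"]) auto
  qed
  finally show ?thesis .
qed

text \<open>
  Opposite frequencies carry the same cosine and, up to sign, the same sine. Giving the cosine to
  one half of the hexagon together with its centre, and the sine to the opposite half, leaves a
  spanning set with one function for each lattice point.
\<close>

definition hexagon_wave :: "real \<Rightarrow> int \<times> int \<Rightarrow> trifun" where
  "hexagon_wave \<alpha> = (\<lambda>(p, q). if p > 0 \<or> p = 0 \<and> q \<ge> 0
     then cosine_wave \<alpha> (2 * p, 2 * q, 0) else sine_wave \<alpha> (2 * p, 2 * q, 0))"

lemma hexagon_space_eq_span: "hexagon_space \<alpha> n = span (hexagon_wave \<alpha> ` hexagon n)"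
proof
  show "span (hexagon_wave \<alpha> ` hexagon n) \<subseteq> hexagon_space \<alpha> n"
  proof (rule span_minimal)
    show "subspace (hexagon_space \<alpha> n)"
      by (simp add: hexagon_space_def wave_space_def)
    have "hexagon_wave \<alpha> (p, q) \<in> hexagon_space \<alpha> n" if "(p, q) \<in> hexagon n" for p q
      using waves_in_wave_space[OF imageI[OF that, of "\<lambda>(p, q). (2 * p, 2 * q, 0)"], of \<alpha>]
      by (simp add: hexagon_wave_def hexagon_space_def)
    then show "hexagon_wave \<alpha> ` hexagon n \<subseteq> hexagon_space \<alpha> n"
      by auto
  qed
  have neg: "cosine_wave \<alpha> (- x, - y, 0) = cosine_wave \<alpha> (x, y, 0)"
    "sine_wave \<alpha> (- x, - y, 0) = - sine_wave \<alpha> (x, y, 0)" for x y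
  proof -
    have "phase (- x, - y, 0) = (\<lambda>p. - phase (x, y, 0) p)"
      by (auto simp: phase_def field_simps)
    then show "cosine_wave \<alpha> (- x, - y, 0) = cosine_wave \<alpha> (x, y, 0)"
      "sine_wave \<alpha> (- x, - y, 0) = - sine_wave \<alpha> (x, y, 0)"
      by (auto simp: cosine_wave_def sine_wave_def on_Omega_def)
  qed
  have *: "cosine_wave \<alpha> (2 * p, 2 * q, 0) \<in> span (hexagon_wave \<alpha> ` hexagon n) \<and>
      sine_wave \<alpha> (2 * p, 2 * q, 0) \<in> span (hexagon_wave \<alpha> ` hexagon n)"
    if pq: "(p, q) \<in> hexagon n" for p q
  proof -
    have "(- p, - q) \<in> hexagon n"
      using pq by (auto simp: hexagon_def)
    then have h: "hexagon_wave \<alpha> (p, q) \<in> span (hexagon_wave \<alpha> ` hexagon n)"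
      "hexagon_wave \<alpha> (- p, - q) \<in> span (hexagon_wave \<alpha> ` hexagon n)"
      using pq by (auto intro: span_base)
    consider "p = 0" "q = 0" | "p > 0 \<or> p = 0 \<and> q > 0" | "p < 0 \<or> p = 0 \<and> q < 0"
      by linarith
    then show ?thesis
    proof cases
      case 1
      have "sine_wave \<alpha> (0, 0, 0) = 0"
        by (auto simp: sine_wave_def on_Omega_def phase_def)
      then show ?thesis
        using 1 h by (simp add: hexagon_wave_def span_zero)
    next
      case 2
      then have "hexagon_wave \<alpha> (p, q) = cosine_wave \<alpha> (2 * p, 2 * q, 0)"
        "hexagon_wave \<alpha> (- p, - q) = - sine_wave \<alpha> (2 * p, 2 * q, 0)"
        using neg[of "2 * p" "2 * q"] by (auto simp: hexagon_wave_def)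
      then show ?thesis
        using h by (metis minus_minus span_neg)
    next
      case 3
      then have "hexagon_wave \<alpha> (p, q) = sine_wave \<alpha> (2 * p, 2 * q, 0)"
        "hexagon_wave \<alpha> (- p, - q) = cosine_wave \<alpha> (2 * p, 2 * q, 0)"
        using neg[of "2 * p" "2 * q"] by (auto simp: hexagon_wave_def)
      then show ?thesis
        using h by simp
    qed
  qed
  show "hexagon_space \<alpha> n \<subseteq> span (hexagon_wave \<alpha> ` hexagon n)"
    unfolding hexagon_space_def by (rule wave_space_subset_span) (auto simp: *)
qed

text \<open>
  The columns with \<open>p = a \<ge> 0\<close> have \<open>2 n - a + 1\<close> points, enumerated downwards from \<open>q = n\<close>; those with
  \<open>p = - a - 1 < 0\<close> have \<open>2 n - a\<close> points, enumerated upwards from \<open>q = - n\<close>.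
\<close>

lemma finite_card_hexagon: "finite (hexagon n) \<and> card (hexagon n) \<le> 3 * n * (n + 1) + 1"
proof -
  define A where "A = (SIGMA a:{..n}. {..2*n - a})"
  define B where "B = (SIGMA a:{..<n}. {..<2*n - a})"
  let ?f = "\<lambda>(a, b). (int a, int n - int b)" and ?g = "\<lambda>(a, b). (- int a - 1, int b - int n)"
  have fin: "finite A" "finite B"
    by (auto simp: A_def B_def)
  have sub: "hexagon n \<subseteq> ?f ` A \<union> ?g ` B"
  proof
    fix k assume k: "k \<in> hexagon n"
    obtain p q where pq: "k = (p, q)"
      by (cases k)
    show "k \<in> ?f ` A \<union> ?g ` B"
    proof (cases "p \<ge> 0")
      case True
      then have "k = ?f (nat p, nat (int n - q))" "(nat p, nat (int n - q)) \<in> A"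
        using k pq by (auto simp: hexagon_def A_def)
      then show ?thesis
        by blast
    next
      case False
      then have "k = ?g (nat (- p - 1), nat (q + int n))" "(nat (- p - 1), nat (q + int n)) \<in> B"
        using k pq by (auto simp: hexagon_def B_def)
      then show ?thesis
        by blast
    qed
  qed
  have sumA: "(\<Sum>a\<le>m. Suc (2*n - a)) * 2 = (m + 1) * (4 * n + 2 - m)" if "m \<le> n" for m
    using that
  proof (induction m)
    case (Suc m)
    then obtain d where "n = Suc m + d"
      using le_Suc_ex by blast
    then show ?case
      using Suc by (simp add: algebra_simps)
  qed simp
  have sumB: "(\<Sum>a<m. 2*n - a) * 2 = m * (4 * n + 1 - m)" if "m \<le> n" for m
    using that
  proof (induction m)
    case (Suc m)
    then obtain d where "n = Suc m + d"
      using le_Suc_ex by blast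
    then show ?case
      using Suc by (simp add: algebra_simps)
  qed simp
  have "card (hexagon n) \<le> card (?f ` A) + card (?g ` B)"
    using sub fin by (meson card_Un_le card_mono finite_UnI finite_imageI le_trans)
  also have "\<dots> \<le> card A + card B"
    using fin by (intro add_mono card_image_le)
  also have "\<dots> = 3 * n * (n + 1) + 1"
    using sumA[of n] sumB[of n] by (simp add: A_def B_def algebra_simps)
  finally show ?thesis
    using sub fin by (meson finite_UnI finite_imageI finite_subset)
qed

section \<open>The joint system as a basis\<close>

lemma T_index_eq:
  assumes "1 \<le> n"
  shows "T_index n = {Red, Green, Blue} \<times> shell_index n \<union> {(Red, n, n)}"
proof -
  have "c \<in> {Red, Green, Blue}" for c
    by (cases c) auto
  moreover have "j \<le> n - 1 \<and> j \<le> i \<and> i \<le> 2 * n - 1 - j \<longleftrightarrow> (i, j) \<in> shell_index n" for i j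
    using assms by (auto simp: shell_index_def)
  ultimately show ?thesis
    unfolding T_index_def by auto
qed

lemma top_not_in_shell_index: "(n, n) \<notin> shell_index n"
  by (simp add: shell_index_def)

lemma sum_T_index:
  fixes f :: "letter \<times> nat \<times> nat \<Rightarrow> 'a::comm_monoid_add"
  assumes "1 \<le> n"
  shows "(\<Sum>k\<in>T_index n. f k) =
    (\<Sum>(i, j)\<in>shell_index n. f (Red, i, j) + f (Green, i, j) + f (Blue, i, j)) + f (Red, n, n)"
proof -
  have "(\<Sum>k\<in>T_index n. f k) = (\<Sum>k\<in>{Red, Green, Blue} \<times> shell_index n. f k) + f (Red, n, n)"
    unfolding T_index_eq[OF assms] using top_not_in_shell_index by (subst sum.union_disjoint) auto
  also have "(\<Sum>k\<in>{Red, Green, Blue} \<times> shell_index n. f k)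
      = (\<Sum>c\<in>{Red, Green, Blue}. \<Sum>k\<in>shell_index n. f (c, k))"
    by (simp add: sum.cartesian_product)
  finally show ?thesis
    by (simp add: sum.distrib case_prod_unfold add_ac)
qed

lemma card_shell_index: "card (shell_index n) = n * (n + 1)"
proof -
  have "bij_betw prod.swap (SIGMA j:{..<n}. {j..<2*n - j}) (shell_index n)"
    by (rule bij_betwI[of _ _ _ prod.swap]) (auto simp: shell_index_def)
  then have "card (shell_index n) = (\<Sum>j<n. 2 * n - 2 * j)"
    by (simp add: bij_betw_same_card[symmetric] mult_2)
  also have "\<dots> = (\<Sum>j<n. 2 * Suc j)"
    by (subst sum.nat_diff_reindex[symmetric]) (intro sum.cong, auto)
  also have "\<dots> = n * (n + 1)"
    by (induction n) auto
  finally show ?thesis .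
qed

lemma finite_card_T_index:
  assumes "1 \<le> n"
  shows "finite (T_index n)" "card (T_index n) = 3 * n * (n + 1) + 1"
  unfolding T_index_eq[OF assms] using top_not_in_shell_index[of n]
  by (simp_all add: card_Un_disjoint card_cartesian_product card_shell_index)

theorem theorem4p1:
  fixes \<alpha> :: real and n :: nat
  assumes "0 < \<alpha>" and "\<alpha> < pi" and "1 \<le> n"
  shows "basis_family (T_fun \<alpha> n) (T_index n) (span (trig_system \<alpha> n)) \<and>
         (\<forall>V. largest_independent_subset V (trig_system \<alpha> n) \<longrightarrow>
            span (T_system \<alpha> n) = span V \<and> span V = span (trig_system \<alpha> n))"
proof -
  have span_eq: "span (trig_system \<alpha> n) = span (hexagon_wave \<alpha> ` hexagon n)"
    by (simp add: span_trig_system hexagon_space_eq_span)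
  have basis: "basis_family (T_fun \<alpha> n) (T_index n) (span (hexagon_wave \<alpha> ` hexagon n))"
  proof (rule basis_familyI)
    fix c k assume sum0: "(\<Sum>k\<in>T_index n. c k *\<^sub>R T_fun \<alpha> n k) = 0" and k: "k \<in> T_index n"
    define r g b where "r = (\<lambda>i j. c (Red, i, j))" "g = (\<lambda>i j. c (Green, i, j))"
      "b = (\<lambda>i j. c (Blue, i, j))"
    have "c (Red, n, n) = 0 \<and> (\<forall>(i, j)\<in>shell_index n. r i j = 0 \<and> g i j = 0 \<and> b i j = 0)"
    proof (rule joint_coefficients_zero[OF assms(1,2)])
      fix u v w :: real assume "0 < u" "0 < v" "0 < w" "u + v + w = \<alpha>"
      then have "(u, v, w) \<in> Omega \<alpha>"
        by (simp add: Omega_def)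
      then have "joint n r g b (c (Red, n, n)) (u, v, w) = (\<Sum>k\<in>T_index n. c k * T_fun \<alpha> n k (u, v, w))"
        unfolding sum_T_index[OF assms(3)] joint_def by (simp add: on_Omega_def r_g_b_def)
      also have "\<dots> = (\<Sum>k\<in>T_index n. c k *\<^sub>R T_fun \<alpha> n k) (u, v, w)"
        by (simp add: sum_apply scaleR_fun_def)
      finally show "joint n r g b (c (Red, n, n)) (u, v, w) = 0"
        by (simp add: sum0)
    qed
    then show "c k = 0"
      using k by (auto simp: T_index_eq[OF assms(3)] r_g_b_def)
  next
    show "T_fun \<alpha> n ` T_index n \<subseteq> span (hexagon_wave \<alpha> ` hexagon n)"
      unfolding hexagon_space_eq_span[symmetric] T_index_eq[OF assms(3)]
      by (auto simp del: T_fun.simps simp: shell_index_def intro!: T_fun_in_hexagon_space)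
  next
    show "card (hexagon_wave \<alpha> ` hexagon n) \<le> card (T_index n)"
      using finite_card_hexagon[of n] card_image_le[of "hexagon n" "hexagon_wave \<alpha>"]
      by (simp add: finite_card_T_index[OF assms(3)])
  qed (use finite_card_T_index[OF assms(3)] finite_card_hexagon[of n] in simp_all)
  have "finite (trig_system \<alpha> n)"
    by (simp add: trig_system_def)
  then have "span V = span (trig_system \<alpha> n)" if "largest_independent_subset V (trig_system \<alpha> n)" for V
    using that by (rule span_largest_independent_subset)
  then show ?thesis
    using basis by (simp add: basis_family_def T_system_def span_eq)
qed

end
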